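(* Let $K$ be a field of characteristic zero and let $\mathcal{A}$ be a $K$-algebra such that every $K$-subalgebra of $\mathcal{A}$ generated by finitely many elements of $\mathcal{A}$ is finite dimensional over $K$. Let $\delta$ be a locally finite $K$-derivation of $\mathcal{A}$ or a locally finite $K$-$\mathcal{E}$-derivation of $\mathcal{A}$, and assume that $\delta$ satisfies one of the following two conditions: 1) $\delta$ is a $K$-derivation of $\mathcal{A}$; 2) $\delta=\mathrm{I}-\phi$ for some $K$-algebra automorphism $\phi$ of $\mathcal{A}$. Then the image $\operatorname{Im}\delta=\delta(\mathcal{A})$ does not contain any nonzero idempotent of $\mathcal{A}$.
   Context: Algebras are associative, not necessarily commutative. $\mathrm{I}$ denotes the identity map of $\mathcal{A}$. $K$-algebra endomorphisms are $K$-linear multiplicative maps (not required to preserve an identity element). A $K$-linear endomorphism $\eta$ of $\mathcal{A}$ is locally finite if for each $a\in\mathcal{A}$ the $K$-subspace spanned by $\eta^i(a)$ $(i\ge 0)$ is finite dimensional. A $K$-derivation of $\mathcal{A}$ is a $K$-linear map $D:\mathcal{A}\to\mathcal{A}$ with $D(ab)=D(a)b+aD(b)$ for all $a,b\in\mathcal{A}$. A $K$-$\mathcal{E}$-derivation of $\mathcal{A}$ is a $K$-linear map $\delta:\mathcal{A}\to\mathcal{A}$ with $\delta(ab)=\delta(a)b+a\delta(b)-\delta(a)\delta(b)$ for all $a,b\in\mathcal{A}$; equivalently, $\delta=\mathrm{I}-\phi$ for some $K$-algebra endomorphism $\phi$ of $\mathcal{A}$. An idempotent is an element $e$ with $e^2=e$.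 *)

theory Defs
  imports Complex_Main "HOL.Hull"
begin

text \<open>
  Algebras are associative and not assumed to be commutative or unital: the class \<open>ring\<close>
  has no multiplicative identity. Unital algebras are covered as well; adjoining the identity
  to a subalgebra does not affect whether it is finite dimensional.
\<close>

locale assoc_algebra = vector_space scale
  for scale :: "'k::field \<Rightarrow> 'a::ring \<Rightarrow> 'a" (infixr \<open>*s\<close> 75) +
  assumes mult_scale_left: "(c *s x) * y = c *s (x * y)"
    and mult_scale_right: "x * (c *s y) = c *s (x * y)"
begin

definition fin_dim :: "'a set \<Rightarrow> bool" where
  "fin_dim V \<longleftrightarrow> (\<exists>B. finite B \<and> V = span B)"

definition subalgebra :: "'a set \<Rightarrow> bool" where
  "subalgebra B \<longleftrightarrow> subspace B \<and> (\<forall>x\<in>B. \<forall>y\<in>B. x * y \<in> B)"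

definition generated_subalgebra :: "'a set \<Rightarrow> 'a set" where
  "generated_subalgebra S = subalgebra hull S"

definition linear_endo :: "('a \<Rightarrow> 'a) \<Rightarrow> bool" where
  "linear_endo f \<longleftrightarrow> Vector_Spaces.linear scale scale f"

definition algebra_endo :: "('a \<Rightarrow> 'a) \<Rightarrow> bool" where
  "algebra_endo \<phi> \<longleftrightarrow> linear_endo \<phi> \<and> (\<forall>a b. \<phi> (a * b) = \<phi> a * \<phi> b)"

definition algebra_auto :: "('a \<Rightarrow> 'a) \<Rightarrow> bool" where
  "algebra_auto \<phi> \<longleftrightarrow> algebra_endo \<phi> \<and> bij \<phi>"

definition locally_finite :: "('a \<Rightarrow> 'a) \<Rightarrow> bool" where
  "locally_finite \<eta> \<longleftrightarrow>
     linear_endo \<eta> \<and> (\<forall>a. fin_dim (span {(\<eta> ^^ i) a | i. True}))"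

definition derivation :: "('a \<Rightarrow> 'a) \<Rightarrow> bool" where
  "derivation D \<longleftrightarrow> linear_endo D \<and> (\<forall>a b. D (a * b) = D a * b + a * D b)"

definition E_derivation :: "('a \<Rightarrow> 'a) \<Rightarrow> bool" where
  "E_derivation \<delta> \<longleftrightarrow>
     linear_endo \<delta> \<and> (\<forall>a b. \<delta> (a * b) = \<delta> a * b + a * \<delta> b - \<delta> a * \<delta> b)"

end

definition idempotent :: "'a::times \<Rightarrow> bool" where
  "idempotent e \<longleftrightarrow> e * e = e"

end

theory Submission
  imports Defs
begin

text \<open>
  Suppose \<open>e = \<delta> a\<close> is idempotent. As \<open>\<delta>\<close> is locally finite, the span of the orbit
  \<open>a, \<delta> a, \<delta>\<^sup>2 a, \<dots>\<close> has a finite spanning set; the subalgebra \<open>B\<close> generated by that set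
  is finite dimensional, and it is \<open>\<delta>\<close>-stable because \<open>\<delta> (x * y)\<close> is a combination of products
  of \<open>x\<close>, \<open>y\<close>, \<open>\<delta> x\<close>, \<open>\<delta> y\<close> (lemma \<open>locally_finite_in_stable_subalgebra\<close>).

  On \<open>B\<close> one can take traces. Write \<open>L\<^sub>x\<close> for left multiplication by \<open>x\<close>. If \<open>\<delta>\<close> is a derivation,
  then \<open>L\<^bsub>\<delta> a\<^esub>\<close> is the commutator of \<open>\<delta>\<close> and \<open>L\<^sub>a\<close>. If \<open>\<delta> = I - \<phi>\<close> with \<open>\<phi>\<close> an automorphism, then
  \<open>L\<^bsub>\<phi> a\<^esub>\<close> is the conjugate of \<open>L\<^sub>a\<close> by \<open>\<phi>\<close>. In both cases \<open>L\<^sub>e\<close> has trace \<open>0\<close>, by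
  \<open>trace_on_comp_commute\<close>.  But \<open>L\<^sub>e\<close> is a projection, so its trace is also its rank, and in
  characteristic zero the rank must vanish. Hence \<open>e B = 0\<close>, and \<open>e = e * e = 0\<close>.

  Traces are computed in coordinates. Their independence of the basis can be bypassed:
  the vanishing of the trace of \<open>L\<^sub>e\<close> holds for every basis of \<open>B\<close>, so the basis may be chosen
  to extend one of \<open>e B\<close> from the start.
\<close>

section \<open>Traces on finite-dimensional subspaces\<close>

text \<open>Here \<open>C\<close> is meant to be a finite basis of its span. Only the values of \<open>f\<close> on \<open>C\<close> enter, so \<open>f\<close> may be a map of the whole space for which
  \<open>span C\<close> is stable; the value is then the trace of its restriction to \<open>span C\<close>.\<close>

definition (in vector_space) trace_on :: "'b set \<Rightarrow> ('b \<Rightarrow> 'b) \<Rightarrow> 'a" where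
  "trace_on C f = (\<Sum>b\<in>C. representation C (f b) b)"

(* The locale vector_space is interpreted for real vector spaces under an optional
   qualifier; the real instance would otherwise capture the unqualified name. *)
hide_const (open) real_vector.trace_on

context vector_space
begin

lemma trace_on_diff:
  assumes "independent C" "f ` C \<subseteq> span C" "g ` C \<subseteq> span C"
  shows "trace_on C (\<lambda>x. f x - g x) = trace_on C f - trace_on C g"
  unfolding trace_on_def sum_subtractf[symmetric]
  by (rule sum.cong) (use assms in \<open>auto simp: representation_diff image_subset_iff\<close>)

lemma representation_linear_image:
  assumes "finite C" "independent C" "Vector_Spaces.linear scale scale f"
    and "f ` C \<subseteq> span C" "v \<in> span C"
  shows "representation C (f v) d =
    (\<Sum>c\<in>C. representation C v c * representation C (f c) d)"
proof -
  interpret f: Vector_Spaces.linear scale scale f by (fact assms(3))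
  have "v = (\<Sum>c\<in>C. scale (representation C v c) c)"
    using sum_representation_eq[OF assms(2,5,1) order_refl] by simp
  then have "f v = f (\<Sum>c\<in>C. scale (representation C v c) c)"
    by (rule arg_cong)
  also have "\<dots> = (\<Sum>c\<in>C. scale (representation C v c) (f c))"
    by (simp add: f.sum f.scale)
  finally have "representation C (f v) d =
      representation C (\<Sum>c\<in>C. scale (representation C v c) (f c)) d"
    by simp
  also have "\<dots> = (\<Sum>c\<in>C. representation C (scale (representation C v c) (f c)) d)"
    using assms by (subst representation_sum) (auto simp: image_subset_iff intro: span_scale)
  also have "\<dots> = (\<Sum>c\<in>C. representation C v c * representation C (f c) d)"
    using assms by (intro sum.cong) (auto simp: representation_scale image_subset_iff)
  finally show ?thesis .
qed

lemma trace_on_comp_commute: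
  assumes "finite C" "independent C"
    and "Vector_Spaces.linear scale scale f" "Vector_Spaces.linear scale scale g"
    and "f ` C \<subseteq> span C" "g ` C \<subseteq> span C"
  shows "trace_on C (\<lambda>x. f (g x)) = trace_on C (\<lambda>x. g (f x))"
proof -
  have "trace_on C (\<lambda>x. f (g x)) =
      (\<Sum>b\<in>C. \<Sum>c\<in>C. representation C (g b) c * representation C (f c) b)"
    unfolding trace_on_def
    by (rule sum.cong) (use assms representation_linear_image[of C f] in \<open>auto simp: image_subset_iff\<close>)
  also have "\<dots> = (\<Sum>c\<in>C. \<Sum>b\<in>C. representation C (f c) b * representation C (g b) c)"
    by (subst sum.swap) (simp add: mult.commute)
  also have "\<dots> = trace_on C (\<lambda>x. g (f x))"
    unfolding trace_on_def
    by (rule sum.cong) (use assms representation_linear_image[of C g] in \<open>auto simp: image_subset_iff\<close>)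
  finally show ?thesis .
qed

text \<open>In a basis that extends one of the image, the matrix of a projection has diagonal
  entries \<open>1\<close> at the image vectors. The entry at any other basis vector \<open>b\<close> is \<open>0\<close>, since
  the image of \<open>b\<close> is a combination of the image vectors alone.\<close>

lemma trace_on_projection:
  assumes "finite C" "independent C" "C0 \<subseteq> C"
    and id: "\<And>x. x \<in> C0 \<Longrightarrow> p x = x" and img: "p ` C \<subseteq> span C0"
  shows "trace_on C p = of_nat (card C0)"
proof -
  have "representation C (p b) b = (if b \<in> C0 then 1 else 0)" if "b \<in> C" for b
  proof (cases "b \<in> C0")
    case True
    then show ?thesis using representation_basis[OF assms(2) that] id by simp
  next
    case False
    have "representation C (p b) = representation C0 (p b)"
      using representation_extend[OF assms(2) _ assms(3)] img that by blast
    then show ?thesis using False representation_ne_zero[of C0 "p b" b] by auto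
  qed
  then have "trace_on C p = (\<Sum>b\<in>C. if b \<in> C0 then 1 else 0)"
    unfolding trace_on_def by simp
  also have "\<dots> = of_nat (card C0)"
    using assms(1,3) by (simp add: sum.If_cases Int_absorb1)
  finally show ?thesis .
qed

text \<open>The image of \<open>C\<close> is independent and as large as \<open>C\<close>; a vector of \<open>span C\<close> outside
  its span would give an independent subset of \<open>span C\<close> with more than \<open>card C\<close> elements.\<close>

lemma injective_linear_onto_span:
  assumes "finite C" "independent C" "Vector_Spaces.linear scale scale f" "inj f"
    and "f ` C \<subseteq> span C"
  shows "f ` span C = span C"
proof -
  interpret f: Vector_Spaces.linear scale scale f by (fact assms(3))
  have ind: "independent (f ` C)"
    by (rule f.independent_injective_image[OF assms(2) inj_on_subset[OF assms(4) subset_UNIV]])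
  have "x \<in> span (f ` C)" if "x \<in> span C" for x
  proof (rule ccontr)
    assume x: "x \<notin> span (f ` C)"
    have "insert x (f ` C) \<subseteq> span C" using assms(5) that by blast
    then have "card (insert x (f ` C)) \<le> card C"
      using independent_span_bound[OF assms(1) independent_insertI[OF x ind]] by blast
    moreover have "x \<notin> f ` C" using x span_base by blast
    then have "card (insert x (f ` C)) = Suc (card C)"
      using \<open>x \<notin> f ` C\<close> assms(1) card_image[OF inj_on_subset[OF assms(4) subset_UNIV], of C]
      by simp
    ultimately show False by simp
  qed
  moreover have "span (f ` C) \<subseteq> span C"
    using assms(5) by (rule span_minimal) simp
  ultimately show ?thesis unfolding f.span_image[symmetric] by blast
qed

end

section \<open>Stable subalgebras and left multiplications\<close>

context assoc_algebra
begin

lemma linear_mult_left: "Vector_Spaces.linear scale scale (\<lambda>x. a * x)"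
  by unfold_locales (simp_all add: distrib_left mult_scale_right)

lemma subalgebra_generated: "subalgebra (generated_subalgebra S)"
  unfolding generated_subalgebra_def
  by (rule hull_in) (auto simp: subalgebra_def subspace_def)

lemma generators_in_generated: "S \<subseteq> generated_subalgebra S"
  unfolding generated_subalgebra_def by (rule hull_subset)

lemma generated_least: "S \<subseteq> T \<Longrightarrow> subalgebra T \<Longrightarrow> generated_subalgebra S \<subseteq> T"
  unfolding generated_subalgebra_def by (rule hull_minimal)

text \<open>The hypothesis \<open>prod\<close> is a common form of the Leibniz rule and its \<open>I - \<phi>\<close> analogue.
  It makes the elements of \<open>B\<close> that \<open>\<delta>\<close> maps into \<open>B\<close> a subalgebra, so it is enough that the
  generators belong to it.\<close>

lemma locally_finite_in_stable_subalgebra: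
  assumes fg: "\<And>S. finite S \<Longrightarrow> fin_dim (generated_subalgebra S)"
    and lf: "locally_finite \<delta>"
    and prod: "\<And>B x y. subalgebra B \<Longrightarrow> x \<in> B \<Longrightarrow> y \<in> B \<Longrightarrow> \<delta> x \<in> B \<Longrightarrow> \<delta> y \<in> B
                  \<Longrightarrow> \<delta> (x * y) \<in> B"
  obtains B where "subalgebra B" "fin_dim B" "\<delta> ` B \<subseteq> B" "a \<in> B"
proof -
  interpret d: Vector_Spaces.linear scale scale \<delta>
    using lf unfolding locally_finite_def linear_endo_def by blast
  define orbit where "orbit = {(\<delta> ^^ i) a | i. True}"
  obtain S where S: "finite S" "span orbit = span S"
    using lf unfolding locally_finite_def fin_dim_def orbit_def by blast
  define B where "B = generated_subalgebra S"
  have B: "subalgebra B" unfolding B_def by (rule subalgebra_generated)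
  then have sB: "subspace B" unfolding subalgebra_def by blast
  have "S \<subseteq> B" unfolding B_def by (rule generators_in_generated)
  then have OB: "span orbit \<subseteq> B" unfolding S(2) using sB by (rule span_minimal)
  have "\<delta> ` orbit \<subseteq> orbit"
    unfolding orbit_def by clarsimp (metis funpow.simps(2) comp_apply)
  then have "\<delta> ` span orbit \<subseteq> span orbit"
    unfolding d.span_image[symmetric] by (rule span_mono)
  then have dS: "\<delta> s \<in> B" if "s \<in> S" for s
    using that OB span_base[of s S] unfolding S(2) by blast
  have "subalgebra {x \<in> B. \<delta> x \<in> B}"
    using B prod[OF B] unfolding subalgebra_def subspace_def
    by (auto simp: d.add d.scale d.zero)
  then have "B \<subseteq> {x \<in> B. \<delta> x \<in> B}"
    using generated_least[of S "{x \<in> B. \<delta> x \<in> B}"] dS \<open>S \<subseteq> B\<close> unfolding B_def by blast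
  then have "\<delta> ` B \<subseteq> B" by blast
  moreover have "(\<delta> ^^ 0) a \<in> orbit" unfolding orbit_def by blast
  then have "a \<in> B" using OB span_base[of a orbit] by auto
  ultimately show thesis using that B fg[OF S(1)] unfolding B_def by blast
qed

lemma trace_on_derivation_image_zero:
  assumes "finite C" "independent C" "subalgebra (span C)"
    and D: "derivation D" "D ` span C \<subseteq> span C" and a: "a \<in> span C"
  shows "trace_on C (\<lambda>x. D a * x) = 0"
proof -
  have lin: "Vector_Spaces.linear scale scale D"
    using D(1) unfolding derivation_def linear_endo_def by blast
  have L: "(\<lambda>x. a * x) ` C \<subseteq> span C"
    using assms(3) a unfolding subalgebra_def by (auto intro: span_base)
  have DC: "D ` C \<subseteq> span C" using D(2) span_superset[of C] by blast
  have "D a * x = D (a * x) - a * D x" for x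
    using D(1) unfolding derivation_def by simp
  then have "trace_on C (\<lambda>x. D a * x) = trace_on C (\<lambda>x. D (a * x) - a * D x)" by simp
  also have "\<dots> = trace_on C (\<lambda>x. D (a * x)) - trace_on C (\<lambda>x. a * D x)"
    using L DC D(2) a assms(3) unfolding subalgebra_def
    by (intro trace_on_diff assms) (blast intro: span_base)+
  also have "\<dots> = 0"
    using trace_on_comp_commute[OF assms(1,2) lin linear_mult_left DC L] by simp
  finally show ?thesis .
qed

lemma trace_on_automorphism_invariant:
  assumes "finite C" "independent C" "subalgebra (span C)"
    and \<phi>: "algebra_auto \<phi>" "\<phi> ` span C \<subseteq> span C" and a: "a \<in> span C"
  shows "trace_on C (\<lambda>x. \<phi> a * x) = trace_on C (\<lambda>x. a * x)"
proof -
  have lin: "Vector_Spaces.linear scale scale \<phi>" and bij: "bij \<phi>"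
    and mult: "\<And>x y. \<phi> (x * y) = \<phi> x * \<phi> y"
    using \<phi>(1) unfolding algebra_auto_def algebra_endo_def linear_endo_def by auto
  interpret p: Vector_Spaces.linear scale scale \<phi> by (fact lin)
  define \<psi> where "\<psi> = inv \<phi>"
  have \<phi>\<psi>: "\<phi> (\<psi> x) = x" and \<psi>\<phi>: "\<psi> (\<phi> x) = x" for x
    unfolding \<psi>_def using bij by (simp_all add: bij_is_surj surj_f_inv_f bij_is_inj)
  have lin\<psi>: "Vector_Spaces.linear scale scale \<psi>"
    by unfold_locales (metis \<phi>\<psi> \<psi>\<phi> p.add, metis \<phi>\<psi> \<psi>\<phi> p.scale)
  have \<phi>C: "\<phi> ` C \<subseteq> span C" using \<phi>(2) span_superset[of C] by blast
  \<comment> \<open>An injective endomorphism of the finite-dimensional \<open>span C\<close> is onto, so the global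
     inverse preserves \<open>span C\<close> as well.\<close>
  have "\<phi> ` span C = span C"
    using injective_linear_onto_span[OF assms(1,2) lin bij_is_inj[OF bij] \<phi>C] .
  then have \<psi>C: "\<psi> x \<in> span C" if "x \<in> span C" for x
    using that \<psi>\<phi> by (metis imageE)
  have L: "(\<lambda>x. a * \<psi> x) ` C \<subseteq> span C"
    using assms(3) a \<psi>C unfolding subalgebra_def by (auto intro: span_base)
  have linL: "Vector_Spaces.linear scale scale (\<lambda>x. a * \<psi> x)"
    using Vector_Spaces.linear_compose[OF lin\<psi> linear_mult_left[of a]] by (simp add: comp_def)
  have "trace_on C (\<lambda>x. \<phi> a * x) = trace_on C (\<lambda>x. \<phi> (a * \<psi> x))"
    by (simp add: mult \<phi>\<psi>)
  also have "\<dots> = trace_on C (\<lambda>x. a * \<psi> (\<phi> x))"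
    by (rule trace_on_comp_commute[OF assms(1,2) lin linL \<phi>C L])
  finally show ?thesis by (simp add: \<psi>\<phi>)
qed

end

section \<open>Idempotents of trace zero\<close>

locale assoc_algebra_char_0 = assoc_algebra scale
  for scale :: "'k::field_char_0 \<Rightarrow> 'a::ring \<Rightarrow> 'a"
begin

lemma idempotent_trace_zero:
  assumes B: "subalgebra B" "fin_dim B" and e: "idempotent e" "e \<in> B"
    and tr: "\<And>C. finite C \<Longrightarrow> independent C \<Longrightarrow> span C = B \<Longrightarrow> trace_on C (\<lambda>x. e * x) = 0"
  shows "e = 0"
proof -
  have ee: "e * e = e" using e(1) unfolding idempotent_def .
  have sB: "subspace B" using B(1) unfolding subalgebra_def by blast
  have EB: "(\<lambda>x. e * x) ` B \<subseteq> B" using B(1) e(2) unfolding subalgebra_def by blast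
  \<comment> \<open>\<open>C0\<close> is a basis of the right ideal \<open>e B\<close>, on which left multiplication by \<open>e\<close> is the
     identity; its cardinality is the rank that the trace computes.\<close>
  obtain C0 where C0: "C0 \<subseteq> (\<lambda>x. e * x) ` B" "independent C0" "(\<lambda>x. e * x) ` B \<subseteq> span C0"
    by (rule maximal_independent_subset)
  have "C0 \<subseteq> B" using C0(1) EB by (rule order_trans)
  then obtain C where C: "C0 \<subseteq> C" "C \<subseteq> B" "independent C" "B \<subseteq> span C"
    using C0(2) by (rule maximal_independent_subset_extend)
  obtain T where T: "finite T" "B = span T" using B(2) unfolding fin_dim_def by blast
  have fin: "finite C" using independent_span_bound[OF T(1) C(3)] C(2) T(2) by blast
  have sC: "span C = B" using C(2,4) span_minimal[OF C(2) sB] by blast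
  have "of_nat (card C0) = trace_on C (\<lambda>x. e * x)"
  proof (rule trace_on_projection[symmetric, OF fin C(3,1)])
    show "e * x = x" if "x \<in> C0" for x
      using that C0(1) ee by (auto simp: mult.assoc[symmetric])
    show "(\<lambda>x. e * x) ` C \<subseteq> span C0" using C0(3) C(2) by blast
  qed
  also have "\<dots> = 0" by (rule tr[OF fin C(3) sC])
  finally have "C0 = {}" using finite_subset[OF C(1) fin] by simp
  then have "e * e \<in> {0}" using C0(3) e(2) by auto
  then show ?thesis using ee by simp
qed

end

theorem theorem1p6:
  fixes scale :: "'k::field_char_0 \<Rightarrow> 'a::ring \<Rightarrow> 'a"
    and \<delta> :: "'a \<Rightarrow> 'a"
  assumes "assoc_algebra scale"
    and "\<And>S. finite S \<Longrightarrow>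
           assoc_algebra.fin_dim scale (assoc_algebra.generated_subalgebra scale S)"
    and "assoc_algebra.derivation scale \<delta> \<or> assoc_algebra.E_derivation scale \<delta>"
    and "assoc_algebra.locally_finite scale \<delta>"
    and "assoc_algebra.derivation scale \<delta> \<or>
         (\<exists>\<phi>. assoc_algebra.algebra_auto scale \<phi> \<and> \<delta> = (\<lambda>x. x - \<phi> x))"
  shows "\<not> (\<exists>e \<in> range \<delta>. idempotent e \<and> e \<noteq> 0)"
proof -
  interpret assoc_algebra scale by (fact assms(1))
  interpret assoc_algebra_char_0 scale by unfold_locales
  have prod: "\<delta> (x * y) \<in> B"
    if B: "subalgebra B" "x \<in> B" "y \<in> B" "\<delta> x \<in> B" "\<delta> y \<in> B" for B x y
  proof -
    have sB: "subspace B" and m: "\<And>u v. u \<in> B \<Longrightarrow> v \<in> B \<Longrightarrow> u * v \<in> B"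
      using B(1) unfolding subalgebra_def by auto
    from assms(5) show ?thesis
    proof
      assume "derivation \<delta>"
      then have "\<delta> (x * y) = \<delta> x * y + x * \<delta> y" unfolding derivation_def by blast
      then show ?thesis using B m subspace_add[OF sB] by simp
    next
      assume "\<exists>\<phi>. algebra_auto \<phi> \<and> \<delta> = (\<lambda>x. x - \<phi> x)"
      then obtain \<phi> where \<phi>: "algebra_auto \<phi>" "\<delta> = (\<lambda>x. x - \<phi> x)" by blast
      have "\<delta> (x * y) = x * y - (x - \<delta> x) * (y - \<delta> y)"
        using \<phi>(1) unfolding \<phi>(2) algebra_auto_def algebra_endo_def by simp
      then show ?thesis using B m subspace_diff[OF sB] by simp
    qed
  qed
  have "e = 0" if "e = \<delta> a" "idempotent e" for e a
  proof -
    obtain B where B: "subalgebra B" "fin_dim B" "\<delta> ` B \<subseteq> B" "a \<in> B"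
      using locally_finite_in_stable_subalgebra[OF assms(2,4) prod] by blast
    have sB: "subspace B" using B(1) unfolding subalgebra_def by blast
    show ?thesis
    proof (rule idempotent_trace_zero[OF B(1,2) that(2)])
      show "e \<in> B" using B that(1) by blast
      fix C assume C: "finite C" "independent C" "span C = B"
      from assms(5) show "trace_on C (\<lambda>x. e * x) = 0"
      proof
        assume "derivation \<delta>"
        then show ?thesis
          using trace_on_derivation_image_zero[OF C(1,2)] C(3) B that(1) by simp
      next
        assume "\<exists>\<phi>. algebra_auto \<phi> \<and> \<delta> = (\<lambda>x. x - \<phi> x)"
        then obtain \<phi> where \<phi>: "algebra_auto \<phi>" "\<delta> = (\<lambda>x. x - \<phi> x)" by blast
        have \<phi>B: "\<phi> ` B \<subseteq> B"
        proof
          fix y assume "y \<in> \<phi> ` B"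
          then obtain x where x: "x \<in> B" "y = \<phi> x" by blast
          then have "x - \<delta> x \<in> B" using B(3) subspace_diff[OF sB] by blast
          then show "y \<in> B" using x unfolding \<phi>(2) by simp
        qed
        have inB: "(\<lambda>x. c * x) ` C \<subseteq> span C" if "c \<in> B" for c
          using that B(1) span_superset[of C] C(3) unfolding subalgebra_def by blast
        have "trace_on C (\<lambda>x. e * x) = trace_on C (\<lambda>x. a * x - \<phi> a * x)"
          unfolding that(1) \<phi>(2) by (simp add: left_diff_distrib)
        also have "\<dots> = trace_on C (\<lambda>x. a * x) - trace_on C (\<lambda>x. \<phi> a * x)"
          using B(4) \<phi>B by (intro trace_on_diff C inB) auto
        also have "\<dots> = 0"
          using trace_on_automorphism_invariant[OF C(1,2)] C(3) B(1,4) \<phi>(1) \<phi>B by simp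
        finally show ?thesis .
      qed
    qed
  qed
  then show ?thesis by blast
qed

end
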